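(* Let $\epsilon>0$ and let $b$ be a positive integer with $b>4/\epsilon$. Let $B=\{0,1/b,2/b,\dots,1\}$. Let $m$ be a positive integer and let $S\subseteq B^m$. Set $d=\mathrm{fat}_S(\epsilon/2-2/b)$ and $$y=\sum_{i=0}^d\binom{m}{i}(1+b)^i .$$ Then if $m\ge d$, $$\mathcal M(\epsilon,S)\ \le\ 2\,b^{3(\lfloor\log_2 y\rfloor+1)}\ \le\ 2\,b^{6d\log_2(2bem/d)},$$ where $e$ is the base of the natural logarithm.
   Context: For $v,w\in\mathbb R^m$, $\ell_1(v,w)=\frac1m\sum_{i=1}^m|v_i-w_i|$ (normalized). For $S\subseteq\mathbb R^m$, the packing number $\mathcal M(\epsilon,S)$ is the size of the largest subset $T$ of $S$ such that any two distinct elements $v,w$ of $T$ satisfy $\ell_1(v,w)>\epsilon$. For $S\subseteq[0,1]^m$ and $\gamma>0$, $S$ $\gamma$-fatly shatters a sequence $(i_1,r_1),\dots,(i_d,r_d)$ of elements of $\{1,\dots,m\}\times[0,1]$ if for all $(b_1,\dots,b_d)\in\{0,1\}^d$ there is a $v\in S$ such that for all $j\in\{1,\dots,d\}$: $v_{i_j}\ge r_j+\gamma$ if $b_j=1$, and $v_{i_j}\le r_j-\gamma$ if $b_j=0$. $\mathrm{fat}_S(\gamma)$ is the length of the longest sequence $\gamma$-fatly shattered by $S$.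
   Formalization: The second inequality is stated only for d > 0, since m/d is undefined at d = 0 (and with exponent 0 there it would read 2b^3 ≤ 2, false for b > 1); the first inequality is stated for all d. *)

theory Defs
  imports "HOL-Analysis.Analysis"
begin

definition l1_dist :: "real ^ 'm \<Rightarrow> real ^ 'm \<Rightarrow> real" where
  "l1_dist v w = (1 / real CARD('m)) * (\<Sum>i\<in>UNIV. \<bar>v $ i - w $ i\<bar>)"

(* On nat, Sup is the maximum for a bounded set and 0 for the empty set. The value below is
   meaningful only if the sizes of such subsets T are bounded, e.g. if S is finite. *)
definition packing_number :: "real \<Rightarrow> (real ^ 'm) set \<Rightarrow> nat" where
  "packing_number \<epsilon> S =
     Sup {card T | T. T \<subseteq> S \<and> finite T \<and> (\<forall>v\<in>T. \<forall>w\<in>T. v \<noteq> w \<longrightarrow> l1_dist v w > \<epsilon>)}"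

definition fat_shatters :: "(real ^ 'm) set \<Rightarrow> real \<Rightarrow> ('m \<times> real) list \<Rightarrow> bool" where
  "fat_shatters S \<gamma> s \<longleftrightarrow>
     set s \<subseteq> UNIV \<times> {0..1} \<and>
     (\<forall>bs :: bool list. length bs = length s \<longrightarrow>
        (\<exists>v\<in>S. \<forall>j<length s.
           (bs ! j \<longrightarrow> v $ fst (s ! j) \<ge> snd (s ! j) + \<gamma>) \<and>
           (\<not> bs ! j \<longrightarrow> v $ fst (s ! j) \<le> snd (s ! j) - \<gamma>)))"

(* For \<gamma> > 0 the lengths are bounded by the dimension (fat_shatters_length_le), so Sup is a
   maximum. If S is empty, not even the empty sequence is shattered and the value is 0. *)
definition fat :: "(real ^ 'm) set \<Rightarrow> real \<Rightarrow> nat" where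
  "fat S \<gamma> = Sup {length s | s. fat_shatters S \<gamma> s}"

lemma fat_shatters_length_le:
  fixes S :: "(real ^ 'm) set"
  assumes "\<gamma> > 0" and sh: "fat_shatters S \<gamma> s"
  shows "length s \<le> CARD('m)"
proof -
  have "fst (s ! j) \<noteq> fst (s ! k)" if jk: "j < length s" "k < length s" "j \<noteq> k" for j k
  proof
    assume eq: "fst (s ! j) = fst (s ! k)"
    have "snd (s ! j) < snd (s ! k)"
      if "j < length s" "k < length s" "j \<noteq> k" "fst (s ! j) = fst (s ! k)" for j k
    proof -
      let ?bs = "(replicate (length s) False)[j := True]"
      obtain v where v: "\<forall>i<length s.
          (?bs ! i \<longrightarrow> v $ fst (s ! i) \<ge> snd (s ! i) + \<gamma>) \<and>
          (\<not> ?bs ! i \<longrightarrow> v $ fst (s ! i) \<le> snd (s ! i) - \<gamma>)"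
        using sh unfolding fat_shatters_def by (metis length_list_update length_replicate)
      have "v $ fst (s ! j) \<ge> snd (s ! j) + \<gamma>" "v $ fst (s ! k) \<le> snd (s ! k) - \<gamma>"
        using v that by auto
      then show ?thesis using that \<open>\<gamma> > 0\<close> by simp
    qed
    from this[of j k] this[of k j] show False using jk eq by auto
  qed
  then have "distinct (map fst s)"
    by (auto simp: distinct_conv_nth)
  then have "card (set (map fst s)) = length s"
    by (metis distinct_card length_map)
  then show ?thesis
    by (metis card_mono finite_code subset_UNIV)
qed

end

theory Submission
  imports Defs
begin

text \<open>
  The proof follows the counting argument of Alon, Ben-David, Cesa-Bianchi and Haussler. One
  counts the pairs \<open>(A, f)\<close> of a coordinate set \<open>A\<close> and thresholds \<open>f\<close> on \<open>A\<close> with values in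
  \<open>B\<close> that are shattered. In an \<open>\<epsilon>\<close>-separated set of size at least \<open>q b^3\<close>, averaging the
  distance over all pairs of elements gives a coordinate and two values on it, more than
  \<open>\<epsilon> - 1/b\<close> apart, each taken by at least \<open>q\<close> elements. The two fibres shatter no pair
  involving that coordinate, and a pair shattered by both extends by it, so the number of
  shattered pairs at least doubles. Hence \<open>2 b^(3n)\<close> separated elements shatter at
  least \<open>2^n\<close> pairs, whereas \<open>S\<close> shatters at most \<open>y\<close> of them.
\<close>

section \<open>Shattered pairs and their extension by one coordinate\<close>

text \<open>\<open>E\<close> is the set of coordinates whose bit is 1. Extensionality keeps
  \<open>f\<close> from carrying data outside \<open>A\<close>, so a finite \<open>R\<close> leaves
  finitely many pairs to count.\<close>

definition shattered :: "real set \<Rightarrow> real \<Rightarrow> (real ^ 'm) set \<Rightarrow> ('m set \<times> ('m \<Rightarrow> real)) set" where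
  "shattered R \<gamma> T = {(A, f). f \<in> A \<rightarrow>\<^sub>E R \<and>
     (\<forall>E\<subseteq>A. \<exists>v\<in>T. \<forall>i\<in>A. (i \<in> E \<longrightarrow> v $ i \<ge> f i + \<gamma>) \<and> (i \<notin> E \<longrightarrow> v $ i \<le> f i - \<gamma>))}"

lemma shatteredD:
  assumes "(A, f) \<in> shattered R \<gamma> T" "E \<subseteq> A"
  shows "\<exists>v\<in>T. \<forall>i\<in>A. (i \<in> E \<longrightarrow> v $ i \<ge> f i + \<gamma>) \<and> (i \<notin> E \<longrightarrow> v $ i \<le> f i - \<gamma>)"
  using assms unfolding shattered_def by simp

lemma shattered_mono: "T \<subseteq> U \<Longrightarrow> shattered R \<gamma> T \<subseteq> shattered R \<gamma> U"
  unfolding shattered_def by (clarsimp, meson subsetD)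

lemma finite_shattered:
  assumes "finite R"
  shows "finite (shattered R \<gamma> (T :: (real ^ 'm) set))"
proof (rule finite_subset)
  show "shattered R \<gamma> T \<subseteq> (SIGMA A:UNIV. A \<rightarrow>\<^sub>E R)"
    unfolding shattered_def by auto
  show "finite (SIGMA A:(UNIV :: 'm set set). A \<rightarrow>\<^sub>E R)"
    using assms by (intro finite_SigmaI finite_PiE) auto
qed

lemma shattered_const_coordinate:
  assumes "(A, f) \<in> shattered R \<gamma> T" "\<gamma> > 0" "\<And>v. v \<in> T \<Longrightarrow> v $ i = p"
  shows "i \<notin> A"
proof
  assume i: "i \<in> A"
  have "p \<ge> f i + \<gamma>" using shatteredD[OF assms(1), of A] i assms(3) by auto
  moreover have "p \<le> f i - \<gamma>" using shatteredD[OF assms(1), of "{}"] i assms(3) by auto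
  ultimately show False using \<open>\<gamma> > 0\<close> by linarith
qed

text \<open>Membership of \<open>i\<close> in the pattern \<open>E\<close> selects the witness: from
  \<open>T2\<close> if \<open>i \<in> E\<close>, from \<open>T1\<close> otherwise. Either set
  realizes \<open>E - {i}\<close> on \<open>A\<close>.\<close>

lemma shattered_insert:
  assumes 1: "(A, f) \<in> shattered R \<gamma> T1" and 2: "(A, f) \<in> shattered R \<gamma> T2"
    and T: "T1 \<subseteq> T" "T2 \<subseteq> T" and "r \<in> R" and "i \<notin> A"
    and low: "\<And>v. v \<in> T1 \<Longrightarrow> v $ i \<le> r - \<gamma>" and high: "\<And>v. v \<in> T2 \<Longrightarrow> v $ i \<ge> r + \<gamma>"
  shows "(insert i A, f(i := r)) \<in> shattered R \<gamma> T"
proof -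
  have "\<exists>v\<in>T. \<forall>j\<in>insert i A. (j \<in> E \<longrightarrow> v $ j \<ge> (f(i := r)) j + \<gamma>) \<and>
          (j \<notin> E \<longrightarrow> v $ j \<le> (f(i := r)) j - \<gamma>)" if E: "E \<subseteq> insert i A" for E
  proof -
    have sub: "E - {i} \<subseteq> A" using E by auto
    obtain v1 where v1: "v1 \<in> T1" "\<forall>j\<in>A. (j \<in> E - {i} \<longrightarrow> v1 $ j \<ge> f j + \<gamma>) \<and>
        (j \<notin> E - {i} \<longrightarrow> v1 $ j \<le> f j - \<gamma>)"
      using shatteredD[OF 1 sub] by blast
    obtain v2 where v2: "v2 \<in> T2" "\<forall>j\<in>A. (j \<in> E - {i} \<longrightarrow> v2 $ j \<ge> f j + \<gamma>) \<and>
        (j \<notin> E - {i} \<longrightarrow> v2 $ j \<le> f j - \<gamma>)"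
      using shatteredD[OF 2 sub] by blast
    show ?thesis
    proof (cases "i \<in> E")
      case True
      then show ?thesis using v2 high[OF v2(1)] T \<open>i \<notin> A\<close> by (intro bexI[of _ v2]) auto
    next
      case False
      then show ?thesis using v1 low[OF v1(1)] T \<open>i \<notin> A\<close> by (intro bexI[of _ v1]) auto
    qed
  qed
  moreover have "f(i := r) \<in> insert i A \<rightarrow>\<^sub>E R"
    using 1 \<open>r \<in> R\<close> by (intro PiE_fun_upd) (simp_all add: shattered_def)
  ultimately show ?thesis unfolding shattered_def by blast
qed

text \<open>
  No pair shattered by \<open>T1\<close> or \<open>T2\<close> involves \<open>i\<close>; those shattered by both are counted twice
  on the left, and are accounted for by adding \<open>i\<close> with threshold \<open>r\<close>.
\<close>
lemma card_shattered_superadditive: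
  assumes "finite R" "\<gamma> > 0" "r \<in> R" and T: "T1 \<subseteq> T" "T2 \<subseteq> T"
    and p: "\<And>v. v \<in> T1 \<Longrightarrow> v $ i = p" "p \<le> r - \<gamma>"
    and q: "\<And>v. v \<in> T2 \<Longrightarrow> v $ i = q" "q \<ge> r + \<gamma>"
  shows "card (shattered R \<gamma> T1) + card (shattered R \<gamma> T2) \<le> card (shattered R \<gamma> T)"
proof -
  let ?X = "\<lambda>(A, f). (insert i A, f(i := r))"
  let ?S = "shattered R \<gamma>"
  note fin = finite_shattered[OF \<open>finite R\<close>]
  have notin: "i \<notin> A" if "(A, f) \<in> ?S T1 \<union> ?S T2" for A f
    using that shattered_const_coordinate[OF _ \<open>\<gamma> > 0\<close>] p(1) q(1) by blast
  have inj: "inj_on ?X (?S T1 \<inter> ?S T2)"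
  proof (rule inj_onI, clarsimp)
    fix A f A' f'
    assume a: "(A, f) \<in> ?S T1" "(A', f') \<in> ?S T1" and eq: "insert i A = insert i A'" "f(i := r) = f'(i := r)"
    have i: "i \<notin> A" "i \<notin> A'" using notin a by blast+
    \<comment> \<open>The update at \<open>i\<close> erases the old value, but extensionality fixes
      that value since \<open>i\<close> lies outside the domain; hence \<open>f\<close> is
      recoverable.\<close>
    then have "f i = undefined" "f' i = undefined"
      using a unfolding shattered_def by (auto simp: PiE_def extensional_def)
    then show "A = A' \<and> f = f'"
      using eq i by (metis fun_upd_triv fun_upd_upd insert_ident)
  qed
  have sub: "?X ` (?S T1 \<inter> ?S T2) \<subseteq> ?S T"
    using notin p q \<open>r \<in> R\<close> by (force intro: shattered_insert[OF _ _ T])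
  have disj: "(?S T1 \<union> ?S T2) \<inter> ?X ` (?S T1 \<inter> ?S T2) = {}"
    using notin by fastforce
  have "card (?S T1) + card (?S T2) = card (?S T1 \<union> ?S T2) + card (?S T1 \<inter> ?S T2)"
    by (rule card_Un_Int) (rule fin)+
  also have "\<dots> = card ((?S T1 \<union> ?S T2) \<union> ?X ` (?S T1 \<inter> ?S T2))"
    using fin disj by (subst card_Un_disjoint) (auto simp: card_image[OF inj])
  also have "\<dots> \<le> card (?S T)"
    using sub shattered_mono[OF T(1)] shattered_mono[OF T(2)] fin by (intro card_mono) auto
  finally show ?thesis .
qed

section \<open>Averaging distances in a separated set\<close>

text \<open>Lowering the larger entry by one leaves two distinct numbers below \<open>b\<close>. The
  map \<open>?g\<close> undoes this, so its image of the off-diagonal pairs covers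
  \<open>?P\<close>.\<close>

lemma card_pairs_apart_le:
  "card {(k, l). k \<le> b \<and> l \<le> b \<and> (k + 2 \<le> l \<or> l + 2 \<le> k)} \<le> b ^ 2 - (b :: nat)" (is "card ?P \<le> _")
proof -
  let ?Q = "{..<b} \<times> {..<b} - (\<lambda>x. (x, x)) ` {..<b}"
  let ?g = "\<lambda>(x, y). if x < y then (x, Suc y) else (Suc x, y)"
  have "z \<in> ?g ` ?Q" if "z \<in> ?P" for z
  proof -
    obtain k l where z: "z = (k, l)" by force
    show ?thesis
    proof (cases "k < l")
      case True
      then show ?thesis using that z by (intro image_eqI[of _ _ "(k, l - 1)"]) auto
    next
      case False
      then show ?thesis using that z by (intro image_eqI[of _ _ "(k - 1, l)"]) auto
    qed
  qed
  then have "card ?P \<le> card ?Q"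
    by (intro surj_card_le[where f = ?g]) auto
  also have "\<dots> = b ^ 2 - b"
    by (subst card_Diff_subset) (auto simp: card_image inj_on_def power2_eq_square)
  finally show ?thesis .
qed

text \<open>Otherwise two far values of a coordinate are never both popular, so few pairs of
  elements are far apart there, too few for an average distance above
  \<open>\<epsilon>\<close>.\<close>

lemma exists_popular_value_pair:
  fixes T :: "(real ^ 'm) set"
  assumes "finite T" "b > 0" "\<epsilon> * real b > 4" "q \<ge> 2" and card: "card T \<ge> q * b ^ 3"
    and vals: "\<And>v i. v \<in> T \<Longrightarrow> v $ i \<in> {real k / real b | k. k \<le> b}"
    and sep: "\<And>v w. v \<in> T \<Longrightarrow> w \<in> T \<Longrightarrow> v \<noteq> w \<Longrightarrow> l1_dist v w > \<epsilon>"
  shows "\<exists>i k l. k \<le> b \<and> l \<le> b \<and> real l - real k > \<epsilon> * real b - 1 \<and>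
    card {v\<in>T. v $ i = real k / real b} \<ge> q \<and> card {v\<in>T. v $ i = real l / real b} \<ge> q"
proof (rule ccontr)
  assume neg: "\<not> ?thesis"
  define F where "F i k = {v\<in>T. v $ i = real k / real b}" for i k
  define h where "h = card T"
  define Z where "Z = T \<times> T - (\<lambda>v. (v, v)) ` T"
  \<comment> \<open>The margin \<open>\<epsilon> - c = 1 / b\<close> is what far pairs have to
    supply on average.\<close>
  define c where "c = \<epsilon> - 1 / real b"
  have hq: "q * b ^ 3 \<le> h" using card h_def by simp
  have h2: "h \<ge> 2"
    using hq \<open>q \<ge> 2\<close> \<open>b > 0\<close> by (metis le_trans mult_le_mono nat_mult_1_right one_le_power Suc_leI One_nat_def)
  have c: "c > 0" using \<open>\<epsilon> * real b > 4\<close> \<open>b > 0\<close> by (simp add: c_def field_simps)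
  have c_b: "c * real b = \<epsilon> * real b - 1" using \<open>b > 0\<close> by (simp add: c_def field_simps)
  have finZ: "finite Z" unfolding Z_def using \<open>finite T\<close> by auto
  have cardZ: "card Z = h * h - h"
    unfolding Z_def h_def using \<open>finite T\<close>
    by (subst card_Diff_subset) (auto simp: card_image inj_on_def card_cartesian_product)
  have cardZ': "real (card Z) = real h * (real h - 1)"
    by (simp add: cardZ of_nat_diff algebra_simps)
  have Fh: "card (F i k) \<le> h" for i k
    unfolding F_def h_def using \<open>finite T\<close> by (intro card_mono) auto
  have small: "card (F i k) * card (F i l) \<le> q * h"
    if "k \<le> b" "l \<le> b" "\<bar>real l - real k\<bar> > \<epsilon> * real b - 1" for i k l
  proof -
    have "real l - real k > \<epsilon> * real b - 1 \<or> real k - real l > \<epsilon> * real b - 1"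
      using that(3) by linarith
    \<comment> \<open>By \<open>neg\<close> one fibre has fewer than \<open>q\<close> elements; the
      other has at most \<open>h\<close>.\<close>
    then have "card (F i k) < q \<or> card (F i l) < q"
      using neg that(1,2) unfolding F_def not_ex by (meson not_less)
    then show ?thesis
      using Fh[of i k] Fh[of i l] by (metis less_imp_le mult.commute mult_le_mono)
  qed
  have far: "real (card {(v, w)\<in>Z. \<bar>v $ i - w $ i\<bar> > c}) \<le> (real b ^ 2 - real b) * real q * real h" for i
  proof -
    define P where "P = {(k, l). k \<le> b \<and> l \<le> b \<and> \<bar>real l - real k\<bar> > \<epsilon> * real b - 1}"
    let ?P = "{(k, l). k \<le> b \<and> l \<le> b \<and> (k + 2 \<le> l \<or> l + 2 \<le> k)}"
    have finP: "finite ?P" by (rule finite_subset[of _ "{..b} \<times> {..b}"]) auto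
    \<comment> \<open>The gap \<open>\<epsilon> * b - 1\<close> exceeds 3, so the two indices differ
      by at least 2.\<close>
    have PP: "P \<subseteq> ?P" unfolding P_def using \<open>\<epsilon> * real b > 4\<close> by auto
    have finP': "finite P" using PP finP finite_subset by blast
    have "{(v, w)\<in>Z. \<bar>v $ i - w $ i\<bar> > c} \<subseteq> (\<Union>(k, l)\<in>P. F i k \<times> F i l)"
    proof clarify
      fix v w assume vw: "(v, w) \<in> Z" "\<bar>v $ i - w $ i\<bar> > c"
      then have T: "v \<in> T" "w \<in> T" by (auto simp: Z_def)
      obtain k l where kl: "k \<le> b" "v $ i = real k / real b" "l \<le> b" "w $ i = real l / real b"
        using vals[OF T(1), of i] vals[OF T(2), of i] by auto
      have "c < \<bar>real k - real l\<bar> / real b"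
        using vw(2) kl by (simp add: diff_divide_distrib[symmetric])
      then have "\<bar>real l - real k\<bar> > \<epsilon> * real b - 1"
        using \<open>b > 0\<close> c_b by (simp add: pos_less_divide_eq abs_minus_commute)
      then show "(v, w) \<in> (\<Union>(k, l)\<in>P. F i k \<times> F i l)"
        using kl T unfolding P_def F_def by blast
    qed
    then have "card {(v, w)\<in>Z. \<bar>v $ i - w $ i\<bar> > c} \<le> card (\<Union>(k, l)\<in>P. F i k \<times> F i l)"
      using finP' \<open>finite T\<close> by (intro card_mono) (auto simp: F_def)
    also have "\<dots> \<le> (\<Sum>z\<in>P. card (case z of (k, l) \<Rightarrow> F i k \<times> F i l))"
      by (rule card_UN_le[OF finP'])
    also have "\<dots> \<le> (\<Sum>z\<in>P. q * h)"
      using small by (intro sum_mono) (auto simp: P_def card_cartesian_product)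
    also have "\<dots> \<le> (b ^ 2 - b) * (q * h)"
      using card_mono[OF finP PP] card_pairs_apart_le[of b] by (simp only: sum_constant of_nat_id) (meson mult_le_mono1 le_trans)
    finally have "real (card {(v, w)\<in>Z. \<bar>v $ i - w $ i\<bar> > c}) \<le> real ((b ^ 2 - b) * (q * h))"
      by (rule of_nat_mono)
    also have "\<dots> = (real b ^ 2 - real b) * real q * real h"
      by (simp add: of_nat_diff power2_eq_square)
    finally show ?thesis .
  qed
  have coord: "(\<Sum>(v, w)\<in>Z. \<bar>v $ i - w $ i\<bar>)
      \<le> real h * (real h - 1) * c + (real b ^ 2 - real b) * real q * real h" for i
  proof -
    \<comment> \<open>Near pairs contribute at most \<open>c\<close>, far ones at most 1 because all
      values lie in [0, 1].\<close>
    have "(\<Sum>(v, w)\<in>Z. \<bar>v $ i - w $ i\<bar>)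
        \<le> (\<Sum>z\<in>Z. c + of_bool (z \<in> {(v, w). \<bar>v $ i - w $ i\<bar> > c}))"
    proof (rule sum_mono, clarify)
      fix v w assume "(v, w) \<in> Z"
      then have T: "v \<in> T" "w \<in> T" by (auto simp: Z_def)
      have "0 \<le> u $ i \<and> u $ i \<le> 1" if "u \<in> T" for u
        using vals[OF that, of i] \<open>b > 0\<close> by auto
      from this[OF T(1)] this[OF T(2)]
      show "\<bar>v $ i - w $ i\<bar> \<le> c + of_bool ((v, w) \<in> {(v, w). \<bar>v $ i - w $ i\<bar> > c})"
        using c by auto
    qed
    also have "\<dots> = real (card Z) * c + real (card {(v, w)\<in>Z. \<bar>v $ i - w $ i\<bar> > c})"
      using finZ by (simp add: sum.distrib sum.If_cases of_bool_def)
        (rule arg_cong[where f = card], auto)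
    finally show ?thesis using far[of i] cardZ' by simp
  qed
  have "real h * (real h - 1) * \<epsilon> = (\<Sum>z\<in>Z. \<epsilon>)"
    by (simp add: cardZ')
  also have "\<dots> \<le> (\<Sum>(v, w)\<in>Z. l1_dist v w)"
    using sep by (intro sum_mono) (auto simp: Z_def intro!: less_imp_le)
  also have "\<dots> = (1 / real CARD('m)) * (\<Sum>i\<in>(UNIV :: 'm set). \<Sum>(v, w)\<in>Z. \<bar>v $ i - w $ i\<bar>)"
    unfolding l1_dist_def case_prod_beta sum_distrib_left[symmetric] by (subst sum.swap) simp
  also have "\<dots> \<le> (1 / real CARD('m)) *
      (\<Sum>i\<in>(UNIV :: 'm set). real h * (real h - 1) * c + (real b ^ 2 - real b) * real q * real h)"
    by (intro mult_left_mono sum_mono coord) auto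
  also have "\<dots> = real h * ((real h - 1) * c + (real b ^ 2 - real b) * real q)"
    by (simp add: algebra_simps)
  finally have "(real h - 1) * \<epsilon> \<le> (real h - 1) * c + (real b ^ 2 - real b) * real q"
    using h2 by (simp add: mult.assoc)
  \<comment> \<open>Since \<open>\<epsilon> - c = 1 / b\<close>, multiply by \<open>b\<close>.
    Against \<open>h \<ge> q * b ^ 3\<close> this leaves \<open>q * b ^ 2 \<le> 1\<close>,
    impossible for \<open>q \<ge> 2\<close>.\<close>
  then have "real h - 1 \<le> (real b ^ 3 - real b ^ 2) * real q"
    using \<open>b > 0\<close> by (simp add: c_def field_simps power2_eq_square power3_eq_cube)
  moreover have "real q * real b ^ 3 \<le> real h"
    using of_nat_mono[OF hq, where 'a = real] by simp
  ultimately have "real q * real b ^ 2 \<le> 1" by (simp add: algebra_simps)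
  moreover have "real q * real b ^ 2 \<ge> 2 * 1"
    using \<open>q \<ge> 2\<close> \<open>b > 0\<close> by (intro mult_mono) auto
  ultimately show False by simp
qed

section \<open>Exponential growth of the number of shattered pairs\<close>

lemma power2_le_card_shattered:
  fixes T :: "(real ^ 'm) set"
  assumes "finite T" "b > 0" "\<epsilon> * real b > 4" "card T \<ge> 2 * b ^ (3 * n)"
    and "\<And>v i. v \<in> T \<Longrightarrow> v $ i \<in> {real k / real b | k. k \<le> b}"
    and "\<And>v w. v \<in> T \<Longrightarrow> w \<in> T \<Longrightarrow> v \<noteq> w \<Longrightarrow> l1_dist v w > \<epsilon>"
  shows "2 ^ n \<le> card (shattered {real k / real b | k. k \<le> b} (\<epsilon> / 2 - 2 / real b) T)"
  using assms(1,4-6)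
proof (induction n arbitrary: T)
  case 0
  then obtain v where "v \<in> T" by fastforce
  \<comment> \<open>Every nonempty set shatters the pair with no coordinates.\<close>
  then have "({}, \<lambda>_. undefined) \<in> shattered {real k / real b | k. k \<le> b} (\<epsilon> / 2 - 2 / real b) T"
    unfolding shattered_def by auto
  then show ?case
    using finite_shattered[of "{real k / real b | k. k \<le> b}" "\<epsilon> / 2 - 2 / real b" T]
    by (auto simp: Suc_le_eq card_gt_0_iff)
next
  case (Suc n)
  let ?R = "{real k / real b | k. k \<le> b}"
  let ?\<gamma> = "\<epsilon> / 2 - 2 / real b"
  have g: "?\<gamma> > 0" using \<open>\<epsilon> * real b > 4\<close> \<open>b > 0\<close> by (simp add: field_simps)
  have "2 * b ^ (3 * n) * b ^ 3 \<le> card T"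
    using Suc.prems(2) by (simp add: power_add mult_ac)
  moreover have "2 * b ^ (3 * n) \<ge> 2" using \<open>b > 0\<close> by simp
  \<comment> \<open>With \<open>q = 2 * b ^ (3 * n)\<close> both fibres are large enough for the
    induction hypothesis.\<close>
  ultimately have "\<exists>i k l. k \<le> b \<and> l \<le> b \<and> real l - real k > \<epsilon> * real b - 1 \<and>
      card {v\<in>T. v $ i = real k / real b} \<ge> 2 * b ^ (3 * n) \<and>
      card {v\<in>T. v $ i = real l / real b} \<ge> 2 * b ^ (3 * n)"
    by (intro exists_popular_value_pair Suc.prems assms(2,3))
  then obtain i k l where kl: "k \<le> b" "l \<le> b" "real l - real k > \<epsilon> * real b - 1"
    and card: "card {v\<in>T. v $ i = real k / real b} \<ge> 2 * b ^ (3 * n)"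
      "card {v\<in>T. v $ i = real l / real b} \<ge> 2 * b ^ (3 * n)"
    by blast
  let ?T1 = "{v\<in>T. v $ i = real k / real b}" and ?T2 = "{v\<in>T. v $ i = real l / real b}"
  \<comment> \<open>The midpoint is rounded down to stay on the grid. Rounding costs at most
    \<open>1 / (2 * b)\<close>, so \<open>r\<close> is still more than
    \<open>\<epsilon> / 2 - 1 / b\<close> away from both values, which exceeds
    \<open>?\<gamma>\<close>.\<close>
  define r where "r = real ((k + l) div 2) / real b"
  have half: "2 * real ((k + l) div 2) \<le> real k + real l" "real k + real l \<le> 2 * real ((k + l) div 2) + 1"
    by linarith+
  have r: "r \<in> ?R" unfolding r_def using kl by auto
  have "r - ?\<gamma> = (real ((k + l) div 2) - (\<epsilon> * real b / 2 - 2)) / real b"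
    "r + ?\<gamma> = (real ((k + l) div 2) + (\<epsilon> * real b / 2 - 2)) / real b"
    unfolding r_def using \<open>b > 0\<close> by (simp_all add: field_simps)
  then have low: "real k / real b \<le> r - ?\<gamma>" and high: "real l / real b \<ge> r + ?\<gamma>"
    using half kl(3) by (auto intro!: divide_right_mono)
  have "2 ^ n \<le> card (shattered ?R ?\<gamma> ?T1)"
    using Suc.prems(1,3,4) card(1) by (intro Suc.IH) auto
  moreover have "2 ^ n \<le> card (shattered ?R ?\<gamma> ?T2)"
    using Suc.prems(1,3,4) card(2) by (intro Suc.IH) auto
  moreover have "card (shattered ?R ?\<gamma> ?T1) + card (shattered ?R ?\<gamma> ?T2) \<le> card (shattered ?R ?\<gamma> T)"
    using g r low high by (intro card_shattered_superadditive[where r = r and i = i]) auto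
  ultimately show ?case by simp
qed

section \<open>Upper bounds for the number of shattered pairs\<close>

text \<open>Enumerating \<open>A\<close> without repetition turns a shattered pair into a fatly
  shattered sequence of length \<open>card A\<close>.\<close>

lemma card_le_fat_of_shattered:
  fixes S :: "(real ^ 'm) set"
  assumes "\<gamma> > 0" "R \<subseteq> {0..1}" and A: "(A, f) \<in> shattered R \<gamma> S"
  shows "card A \<le> fat S \<gamma>"
proof -
  obtain xs where xs: "set xs = A" "distinct xs"
    using finite_distinct_list[of A] by auto
  define s where "s = map (\<lambda>i. (i, f i)) xs"
  have "\<exists>v\<in>S. \<forall>j<length s. (bs ! j \<longrightarrow> v $ fst (s ! j) \<ge> snd (s ! j) + \<gamma>) \<and>
      (\<not> bs ! j \<longrightarrow> v $ fst (s ! j) \<le> snd (s ! j) - \<gamma>)"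
    if "length bs = length s" for bs
  proof -
    define E where "E = {xs ! j | j. j < length xs \<and> bs ! j}"
    have "E \<subseteq> A" using xs by (auto simp: E_def)
    then obtain v where v: "v \<in> S"
      "\<forall>i\<in>A. (i \<in> E \<longrightarrow> v $ i \<ge> f i + \<gamma>) \<and> (i \<notin> E \<longrightarrow> v $ i \<le> f i - \<gamma>)"
      using shatteredD[OF A] by blast
    \<comment> \<open>Distinctness of \<open>xs\<close> prevents two positions from imposing
      conflicting bits on one coordinate.\<close>
    have "xs ! j \<in> E \<longleftrightarrow> bs ! j" if "j < length xs" for j
      using that xs(2) by (auto simp: E_def nth_eq_iff_index_eq)
    then show ?thesis using v xs by (intro bexI[of _ v]) (auto simp: s_def)
  qed
  moreover have "set s \<subseteq> UNIV \<times> {0..1}"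
    using A assms(2) xs unfolding s_def shattered_def by (auto simp: PiE_def Pi_def)
  ultimately have "fat_shatters S \<gamma> s" unfolding fat_shatters_def by blast
  \<comment> \<open>\<open>Sup\<close> on \<open>nat\<close> is an upper bound only of a bounded
    set.\<close>
  moreover have "bdd_above {length s | s. fat_shatters S \<gamma> s}"
    using fat_shatters_length_le[OF \<open>\<gamma> > 0\<close>] by (intro bdd_aboveI[of _ "CARD('m)"]) auto
  ultimately have "length s \<le> fat S \<gamma>"
    unfolding fat_def by (intro cSup_upper) auto
  then show ?thesis using xs by (simp add: s_def distinct_card[symmetric])
qed

lemma card_shattered_le:
  fixes S :: "(real ^ 'm) set"
  assumes "\<gamma> > 0" "finite R" "R \<subseteq> {0..1}"
  shows "card (shattered R \<gamma> S) \<le> (\<Sum>i=0..fat S \<gamma>. (CARD('m) choose i) * card R ^ i)"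
proof -
  let ?d = "fat S \<gamma>"
  let ?C = "\<lambda>i. SIGMA A:{A. A \<subseteq> (UNIV :: 'm set) \<and> card A = i}. A \<rightarrow>\<^sub>E R"
  have fin: "finite (?C i)" for i
    using \<open>finite R\<close> by (intro finite_SigmaI finite_PiE) auto
  have "shattered R \<gamma> S \<subseteq> (\<Union>i\<in>{0..?d}. ?C i)"
  proof clarify
    fix A f assume A: "(A, f) \<in> shattered R \<gamma> S"
    then have "f \<in> A \<rightarrow>\<^sub>E R" by (simp add: shattered_def)
    then show "(A, f) \<in> (\<Union>i\<in>{0..?d}. ?C i)"
      using card_le_fat_of_shattered[OF assms(1,3) A] by auto
  qed
  then have "card (shattered R \<gamma> S) \<le> card (\<Union>i\<in>{0..?d}. ?C i)"
    using fin by (intro card_mono) auto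
  also have "\<dots> \<le> (\<Sum>i=0..?d. card (?C i))"
    by (rule card_UN_le) simp
  also have "\<dots> = (\<Sum>i=0..?d. (CARD('m) choose i) * card R ^ i)"
  proof (rule sum.cong[OF refl])
    fix i
    have "card (?C i) = (\<Sum>A | A \<subseteq> (UNIV :: 'm set) \<and> card A = i. card (A \<rightarrow>\<^sub>E R))"
      using \<open>finite R\<close> by (intro card_SigmaI) (auto intro: finite_PiE)
    also have "\<dots> = (\<Sum>A | A \<subseteq> (UNIV :: 'm set) \<and> card A = i. card R ^ i)"
      by (intro sum.cong) (auto simp: card_PiE)
    also have "\<dots> = (CARD('m) choose i) * card R ^ i"
      by (simp only: sum_constant n_subsets[OF finite]) simp
    finally show "card (?C i) = (CARD('m) choose i) * card R ^ i" .
  qed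
  finally show ?thesis .
qed

text \<open>Weight the sum by \<open>x ^ d\<close> with \<open>x = d / m\<close>. For
  \<open>i \<le> d\<close>, \<open>c \<ge> 1\<close> and \<open>x \<le> 1\<close> give
  \<open>c ^ i * x ^ d \<le> c ^ d * x ^ i\<close>; the binomial theorem and
  \<open>1 + x \<le> exp x\<close> finish.\<close>

lemma sum_choose_mult_power_le:
  fixes c :: real
  assumes "0 < d" "d \<le> m" "c \<ge> 1"
  shows "(\<Sum>i=0..d. real (m choose i) * c ^ i) \<le> (c * exp 1 * real m / real d) ^ d"
proof -
  define x where "x = real d / real m"
  have x: "0 < x" "x \<le> 1" using assms by (auto simp: x_def)
  have "x ^ d * (\<Sum>i=0..d. real (m choose i) * c ^ i) = (\<Sum>i=0..d. real (m choose i) * (c ^ i * x ^ d))"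
    by (simp add: sum_distrib_left mult_ac)
  also have "\<dots> \<le> (\<Sum>i=0..d. real (m choose i) * (c ^ d * x ^ i))"
    using x assms by (intro sum_mono mult_left_mono mult_mono power_increasing power_decreasing) auto
  also have "\<dots> \<le> (\<Sum>i\<le>m. real (m choose i) * (c ^ d * x ^ i))"
    using x assms by (intro sum_mono2) auto
  also have "\<dots> = c ^ d * (x + 1) ^ m"
    by (simp add: binomial_ring sum_distrib_left mult_ac)
  also have "\<dots> \<le> c ^ d * exp x ^ m"
    using x assms by (intro mult_left_mono power_mono) (auto simp: add.commute exp_ge_add_one_self)
  \<comment> \<open>The choice of \<open>x\<close> makes \<open>m * x = d\<close>.\<close>
  also have "exp x ^ m = exp 1 ^ d"
    using assms by (simp add: exp_of_nat_mult[symmetric] x_def)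
  finally have "x ^ d * (\<Sum>i=0..d. real (m choose i) * c ^ i) \<le> (c * exp 1) ^ d"
    by (simp add: power_mult_distrib)
  then have "(\<Sum>i=0..d. real (m choose i) * c ^ i) \<le> (c * exp 1) ^ d / x ^ d"
    using x by (simp add: field_simps)
  also have "\<dots> = (c * exp 1 * real m / real d) ^ d"
    by (simp add: x_def power_divide power_mult_distrib)
  finally show ?thesis .
qed

text \<open>The second bound is guarded by \<open>d > 0\<close>: at \<open>d = 0\<close> one has
  \<open>y = 1\<close>, so the middle term is \<open>2 * b ^ 3\<close>, while the exponent on the
  right evaluates to 0 and the right side to 2.\<close>

theorem lemma11:
  fixes \<epsilon> :: real and b m d y :: nat and B :: "real set" and S :: "(real ^ 'm) set"
  assumes "\<epsilon> > 0"
    and "b > 0"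
    and "real b > 4 / \<epsilon>"
    and "B = {real k / real b | k. k \<le> b}"
    and "m = CARD('m)"
    and "S \<subseteq> {v. \<forall>i. v $ i \<in> B}"
    and "d = fat S (\<epsilon> / 2 - 2 / real b)"
    and "y = (\<Sum>i=0..d. (m choose i) * (1 + b) ^ i)"
    and "m \<ge> d"
  shows "real (packing_number \<epsilon> S) \<le> 2 * real b powi (3 * (\<lfloor>log 2 (real y)\<rfloor> + 1)) \<and>
    (d > 0 \<longrightarrow>
      2 * real b powi (3 * (\<lfloor>log 2 (real y)\<rfloor> + 1))
        \<le> 2 * real b powr (6 * real d * log 2 (2 * real b * exp 1 * real m / real d)))"
proof -
  let ?\<gamma> = "\<epsilon> / 2 - 2 / real b"
  \<comment> \<open>The least natural exponent with \<open>y < 2 ^ n\<close>, as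
    \<open>y \<ge> 1\<close>.\<close>
  define n where "n = nat (\<lfloor>log 2 (real y)\<rfloor> + 1)"
  have eb: "\<epsilon> * real b > 4" using assms(1-3) by (simp add: field_simps)
  have g: "?\<gamma> > 0" using eb \<open>b > 0\<close> by (simp add: field_simps)
  have "y \<ge> (\<Sum>i\<in>{0}. (m choose i) * (1 + b) ^ i)"
    unfolding assms(8) by (rule sum_mono2) auto
  then have y: "y \<ge> 1" by simp
  then have n: "\<lfloor>log 2 (real y)\<rfloor> + 1 = int n" by (simp add: n_def)
  have "log 2 (real y) < real n" using n by linarith
  then have "real y < 2 powr real n" using y by (simp add: log_less_iff)
  then have yn: "y < 2 ^ n"
    by (simp add: powr_realpow)
  have powi: "real b powi (3 * (\<lfloor>log 2 (real y)\<rfloor> + 1)) = real b ^ (3 * n)"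
    unfolding n by (simp add: power_int_def nat_mult_distrib)
  have B: "B = (\<lambda>k. real k / real b) ` {..b}" using assms(4) by auto
  have "card B = 1 + b"
    unfolding B using \<open>b > 0\<close> by (subst card_image) (auto simp: inj_on_def)
  moreover have "B \<subseteq> {0..1}" "finite B" using \<open>b > 0\<close> by (auto simp: B)
  ultimately have sh: "card (shattered B ?\<gamma> S) \<le> y"
    using card_shattered_le[of ?\<gamma> B S] g assms(5,7,8) by simp
  have pack: "card T \<le> 2 * b ^ (3 * n)"
    if T: "T \<subseteq> S" "finite T" "\<forall>v\<in>T. \<forall>w\<in>T. v \<noteq> w \<longrightarrow> l1_dist v w > \<epsilon>" for T
  proof (rule ccontr)
    assume "\<not> ?thesis"
    \<comment> \<open>A larger \<open>T\<close> would shatter at least \<open>2 ^ n > y\<close>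
      pairs, more than \<open>S\<close> does.\<close>
    then have "2 ^ n \<le> card (shattered B ?\<gamma> T)"
      unfolding assms(4) using T assms(2,4,6) eb by (intro power2_le_card_shattered) auto
    also have "\<dots> \<le> card (shattered B ?\<gamma> S)"
      using \<open>finite B\<close> T by (intro card_mono finite_shattered shattered_mono)
    finally show False using sh yn by simp
  qed
  have "packing_number \<epsilon> S \<le> 2 * b ^ (3 * n)"
    unfolding packing_number_def
  proof (rule cSup_least)
    show "{card T | T. T \<subseteq> S \<and> finite T \<and> (\<forall>v\<in>T. \<forall>w\<in>T. v \<noteq> w \<longrightarrow> l1_dist v w > \<epsilon>)} \<noteq> {}"
      by auto
  qed (use pack in auto)
  then have "real (packing_number \<epsilon> S) \<le> real (2 * b ^ (3 * n))" by (rule of_nat_mono)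
  moreover have "2 * real b ^ (3 * n)
      \<le> 2 * real b powr (6 * real d * log 2 (2 * real b * exp 1 * real m / real d))" if "d > 0"
  proof -
    define z where "z = 2 * real b * exp 1 * real m / real d"
    have "2 * 1 * 1 * 1 \<le> 2 * real b * exp 1 * (real m / real d)"
      using \<open>b > 0\<close> \<open>d > 0\<close> \<open>m \<ge> d\<close> by (intro mult_mono) auto
    then have z: "z \<ge> 2" by (simp add: z_def)
    have "real y = (\<Sum>i=0..d. real (m choose i) * (1 + real b) ^ i)"
      by (simp add: assms(8))
    also have "\<dots> \<le> ((1 + real b) * exp 1 * real m / real d) ^ d"
      using \<open>d > 0\<close> \<open>m \<ge> d\<close> by (intro sum_choose_mult_power_le) auto
    \<comment> \<open>Here \<open>1 + b \<le> 2 * b\<close>.\<close>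
    also have "\<dots> \<le> z ^ d"
      unfolding z_def using \<open>b > 0\<close> by (intro power_mono divide_right_mono mult_right_mono) auto
    finally have "log 2 (real y) \<le> log 2 (z ^ d)" using y z by simp
    also have "\<dots> = real d * log 2 z" using z by (simp add: log_nat_power)
    finally have "log 2 (real y) \<le> real d * log 2 z" .
    \<comment> \<open>The summand 1 left by the floor is absorbed into
      \<open>d * log 2 z \<ge> 1\<close>, giving \<open>n \<le> 2 * d * log 2 z\<close>; hence the
      factor 6.\<close>
    moreover have "1 * 1 \<le> real d * log 2 z"
      using z \<open>d > 0\<close> by (intro mult_mono) auto
    moreover have "real n \<le> log 2 (real y) + 1" using n by linarith
    ultimately have "real (3 * n) \<le> 6 * real d * log 2 z" by simp
    then have "real b powr real (3 * n) \<le> real b powr (6 * real d * log 2 z)"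
      using \<open>b > 0\<close> by (intro powr_mono) auto
    then show ?thesis using \<open>b > 0\<close> by (simp add: powr_realpow z_def del: of_nat_mult)
  qed
  ultimately show ?thesis unfolding powi by simp
qed

end
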